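(* Let $R$ be a commutative ring with $1$ in which $2$ is invertible, and let $n\ge 2$. Then the subgroup $H(R)$ (which equals $\mathrm{ESp}_{2n}(R)$) is a normal subgroup of $\mathrm{Sp}_{2n}(R)$.
   Context: Let $\psi_1=\begin{pmatrix}0&1\\-1&0\end{pmatrix}$ and let $\psi_n$ be the $2n\times 2n$ block diagonal matrix with $n$ diagonal blocks equal to $\psi_1$. $\mathrm{Sp}_{2n}(R)=\{\alpha\in \mathrm{SL}_{2n}(R): \alpha^t\psi_n\alpha=\psi_n\}$. Let $e_{ij}$ be the $2n\times 2n$ matrix with $1$ in position $(i,j)$ and $0$ elsewhere, $E_{ij}(\lambda)=I_{2n}+\lambda e_{ij}$ for $i\neq j$, and let $\pi$ be the permutation $(1\,2)(3\,4)\cdots(2n-1\;2n)$. For $1\le i\ne j\le 2n$ with $j\neq\pi(i)$, put $S_{ij}(\lambda)=I_{2n}+\lambda e_{ij}-(-1)^{i+j}\lambda e_{\pi(j)\pi(i)}$. The elementary symplectic group $\mathrm{ESp}_{2n}(R)$ is the subgroup of $\mathrm{Sp}_{2n}(R)$ generated by all $E_{21}(x)$, $E_{12}(x)$ ($x\in R$) and all $S_{ij}(\lambda)$ ($\lambda\in R$, $i\ne j$, $j\ne\pi(i)$). For $a\in R$ define the $2\times2$ matrices $A(a)=\begin{pmatrix}a&a\\ a&a\end{pmatrix}$, $B(a)=\begin{pmatrix}a&-a\\ a&-a\end{pmatrix}$, $C(a)=\begin{pmatrix}a&a\\ -a&-a\end{pmatrix}$, $D(a)=\begin{pmatrix}-a&a\\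 a&-a\end{pmatrix}$. View $2n\times 2n$ matrices as $n\times n$ block matrices with $2\times 2$ blocks. For $2\le k\le n$ and $X\in M_2(R)$ with $\det X=0$, $E^k(X)$ denotes the $2n\times2n$ matrix with $2\times 2$ identity blocks on the diagonal, block $X$ in block position $(1,k)$, block $\psi_1X^t\psi_1$ in block position $(k,1)$, and zero blocks elsewhere; it lies in $\mathrm{Sp}_{2n}(R)$. $H(R)$ is the subgroup of $\mathrm{ESp}_{2n}(R)$ generated by all $E^k(A(a)),E^k(B(a)),E^k(C(a)),E^k(D(a))$ with $a\in R$, $2\le k\le n$. *)

theory Defs
  imports
    "HOL-Algebra.Generated_Groups"
    "Jordan_Normal_Form.Determinant"
begin

(* Rows, columns and 2 x 2 blocks are numbered from 0, as in Jordan_Normal_Form.  The customary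
   1-based index i is i - 1 here; the sign (-1)^(i+j) does not change under this shift. *)

definition psi1 :: "'a::comm_ring_1 mat" where
  "psi1 = mat_of_rows_list 2 [[0, 1], [-1, 0]]"

definition psi :: "nat \<Rightarrow> 'a::comm_ring_1 mat" where
  "psi n = diag_block_mat (replicate n psi1)"

definition Sp :: "nat \<Rightarrow> 'a::comm_ring_1 mat monoid" where
  "Sp n = \<lparr>carrier = {\<alpha> \<in> carrier_mat (2 * n) (2 * n).
                       det \<alpha> = 1 \<and> transpose_mat \<alpha> * psi n * \<alpha> = psi n},
           monoid.mult = (*), one = 1\<^sub>m (2 * n)\<rparr>"

definition munit :: "nat \<Rightarrow> nat \<Rightarrow> nat \<Rightarrow> 'a::comm_ring_1 mat" where
  "munit n i j = mat (2 * n) (2 * n) (\<lambda>(r, c). if r = i \<and> c = j then 1 else 0)"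

(* The permutation (1 2)(3 4)...(2n-1 2n), on 0-based indices. *)
definition swap_pair :: "nat \<Rightarrow> nat" where
  "swap_pair i = (if even i then i + 1 else i - 1)"

definition E_elem :: "nat \<Rightarrow> nat \<Rightarrow> nat \<Rightarrow> 'a::comm_ring_1 \<Rightarrow> 'a mat" where
  "E_elem n i j x = 1\<^sub>m (2 * n) + x \<cdot>\<^sub>m munit n i j"

definition S_elem :: "nat \<Rightarrow> nat \<Rightarrow> nat \<Rightarrow> 'a::comm_ring_1 \<Rightarrow> 'a mat" where
  "S_elem n i j x = 1\<^sub>m (2 * n) + x \<cdot>\<^sub>m munit n i j
     - ((-1) ^ (i + j) * x) \<cdot>\<^sub>m munit n (swap_pair j) (swap_pair i)"

definition ESp :: "nat \<Rightarrow> 'a::comm_ring_1 mat set" where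
  "ESp n = generate (Sp n)
     ({E_elem n 1 0 x | x. True} \<union> {E_elem n 0 1 x | x. True} \<union>
      {S_elem n i j x | i j x. i < 2 * n \<and> j < 2 * n \<and> i \<noteq> j \<and> j \<noteq> swap_pair i})"

definition mat_A :: "'a::comm_ring_1 \<Rightarrow> 'a mat" where
  "mat_A a = mat_of_rows_list 2 [[a, a], [a, a]]"

definition mat_B :: "'a::comm_ring_1 \<Rightarrow> 'a mat" where
  "mat_B a = mat_of_rows_list 2 [[a, -a], [a, -a]]"

definition mat_C :: "'a::comm_ring_1 \<Rightarrow> 'a mat" where
  "mat_C a = mat_of_rows_list 2 [[a, a], [-a, -a]]"

definition mat_D :: "'a::comm_ring_1 \<Rightarrow> 'a mat" where
  "mat_D a = mat_of_rows_list 2 [[-a, a], [a, -a]]"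

(* F p q is the 2 x 2 block in block position (p, q). *)
definition of_blocks :: "nat \<Rightarrow> (nat \<Rightarrow> nat \<Rightarrow> 'a mat) \<Rightarrow> 'a::comm_ring_1 mat" where
  "of_blocks n F =
     mat (2 * n) (2 * n) (\<lambda>(i, j). F (i div 2) (j div 2) $$ (i mod 2, j mod 2))"

(* E^(k+1)(X) in 1-based block numbering, so k ranges over 1, ..., n - 1. *)
definition E_block :: "nat \<Rightarrow> nat \<Rightarrow> 'a::comm_ring_1 mat \<Rightarrow> 'a mat" where
  "E_block n k X = of_blocks n (\<lambda>p q.
     if p = q then 1\<^sub>m 2
     else if p = 0 \<and> q = k then X
     else if p = k \<and> q = 0 then psi1 * transpose_mat X * psi1
     else 0\<^sub>m 2 2)"

(* Generated inside Sp n: inverses, and hence the generated subgroup, are the same as in ESp n. *)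
definition H_subgroup :: "nat \<Rightarrow> 'a::comm_ring_1 mat set" where
  "H_subgroup n = generate (Sp n)
     (\<Union>k \<in> {1..<n}. \<Union>a. {E_block n k (mat_A a), E_block n k (mat_B a),
                              E_block n k (mat_C a), E_block n k (mat_D a)})"

end

theory Submission
  imports Defs
begin

text \<open>
  For the symplectic form \<open>\<omega>\<close> and vectors \<open>u\<close>, \<open>v\<close> with \<open>\<omega>(u, v) = 0\<close>, let \<open>T(u, v; c)\<close> be the
  transvection \<open>x \<mapsto> x + c (\<omega>(v, x) u + \<omega>(u, x) v)\<close>. Conjugation by a symplectic \<open>g\<close> takes
  \<open>T(u, v; c)\<close> to \<open>T(g u, g v; c)\<close>, so the transvections generate a normal subgroup. All generators of
  \<open>H\<close> and of \<open>ESp\<close> are transvections. Conversely, both groups contain \<open>T(x, y; c)\<close> whenever \<open>x\<close>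
  lies in the first block, \<open>y\<close> in another one, and both are taken from a fixed basis of \<open>R\<^sup>2\<close>.
  If \<open>\<omega>(a, b) = 0\<close> and \<open>p, q\<close> are orthogonal to \<open>a, b\<close>, then the commutator of \<open>T(p, a; c)\<close> and \<open>T(q, b; d)\<close> is
  \<open>T(a, b; c d \<omega>(p, q))\<close>. With \<open>a = b\<close> this gives \<open>T(a, a; c)\<close>, which are
  the correction terms that make \<open>T(u, w; c)\<close> additive in \<open>u\<close>; so \<open>T(a, b; c)\<close> follows for all
  \<open>a\<close>, \<open>b\<close> in any two blocks. An arbitrary \<open>T(v, v; c)\<close> is a product of these, since the
  block components of \<open>v\<close> are pairwise orthogonal, and \<open>T(u, v; 2 c)\<close> is
  \<open>T(u, u; - c) T(v, v; - c) T(u + v, u + v; c)\<close>.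
\<close>

section \<open>The symplectic form\<close>

lemma swap_pair_swap_pair [simp]: "swap_pair (swap_pair i) = i"
  by (auto simp: swap_pair_def)

lemma swap_pair_eq_iff [simp]: "swap_pair i = swap_pair j \<longleftrightarrow> i = j"
  by (metis swap_pair_swap_pair)

lemma swap_pair_less [simp]: "swap_pair i < 2 * n \<longleftrightarrow> i < 2 * n"
  by (auto simp: swap_pair_def elim!: evenE oddE)

lemma minus_one_power_swap_pair [simp]:
  "(- 1 :: 'a::comm_ring_1) ^ swap_pair i = - ((- 1) ^ i)"
  by (auto simp: swap_pair_def elim!: oddE)

lemma sum_swap_pair: "(\<Sum>i<2 * n. f (swap_pair i)) = (\<Sum>i<2 * n. f i)"
  by (rule sum.reindex_bij_witness[of _ swap_pair swap_pair]) auto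

lemma psi_carrier [simp]: "psi n \<in> carrier_mat (2 * n) (2 * n)"
proof (induction n)
  case (Suc n)
  have "dim_row psi1 = 2" "dim_col psi1 = 2"
    by (simp_all add: psi1_def mat_of_rows_list_def)
  with Suc show ?case
    by (auto simp: psi_def Let_def)
qed (simp add: psi_def)

text \<open>Induction peels off the first diagonal block. Since \<open>swap_pair\<close> commutes
  with the shift of indices by 2, signs and positions of the remaining entries carry over.\<close>

lemma psi_index:
  assumes "i < 2 * n" "j < 2 * n"
  shows "(psi n :: 'a::comm_ring_1 mat) $$ (i, j) = (if j = swap_pair i then (- 1) ^ i else 0)"
  using assms
proof (induction n arbitrary: i j)
  case (Suc n)
  have p: "dim_row (psi1 :: 'a mat) = 2" "dim_col (psi1 :: 'a mat) = 2"
    by (simp_all add: psi1_def mat_of_rows_list_def)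
  have c: "(psi n :: 'a mat) \<in> carrier_mat (2 * n) (2 * n)" by simp
  have eq: "(psi (Suc n) :: 'a mat) = four_block_mat psi1 (0\<^sub>m 2 (2 * n)) (0\<^sub>m (2 * n) 2) (psi n)"
    using carrier_matD[OF c] by (simp add: psi_def Let_def p)
  show ?case
  proof (cases "i < 2")
    case True
    with Suc.prems show ?thesis
      using carrier_matD[OF c]
      by (auto simp: eq p index_mat_four_block(1) less_2_cases_iff swap_pair_def)
        (auto simp: psi1_def mat_of_rows_list_def less_Suc_eq)
  next
    case False
    define i' where "i' = i - 2"
    have i: "i = i' + 2" using False by (simp add: i'_def)
    have s: "swap_pair (i' + 2) = swap_pair i' + 2"
      by (auto simp: swap_pair_def elim!: oddE)
    show ?thesis
    proof (cases "j < 2")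
      case True
      then have "j \<noteq> swap_pair i' + 2" by simp
      with True Suc.prems carrier_matD[OF c] show ?thesis
        unfolding i s by (simp add: eq p index_mat_four_block(1))
    next
      case False
      define j' where "j' = j - 2"
      have j: "j = j' + 2" using False by (simp add: j'_def)
      from Suc.prems Suc.IH[of i' j'] carrier_matD[OF c] show ?thesis
        unfolding i j s by (simp add: eq p index_mat_four_block(1))
    qed
  qed
qed simp

text \<open>The bilinear form with matrix \<open>psi n\<close>. Vectors are functions on all
  naturals, of which only the first \<open>2 * n\<close> values count.\<close>

definition sform :: "nat \<Rightarrow> (nat \<Rightarrow> 'a::comm_ring_1) \<Rightarrow> (nat \<Rightarrow> 'a) \<Rightarrow> 'a" where
  "sform n x y = (\<Sum>i<2 * n. (- 1) ^ i * x i * y (swap_pair i))"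

text \<open>The value 0 outside the range makes \<open>act_mult\<close> an equation between
  functions.\<close>

definition act :: "nat \<Rightarrow> 'a::comm_ring_1 mat \<Rightarrow> (nat \<Rightarrow> 'a) \<Rightarrow> nat \<Rightarrow> 'a" where
  "act n A x = (\<lambda>i. if i < 2 * n then \<Sum>j<2 * n. A $$ (i, j) * x j else 0)"

text \<open>The entries below use \<open>\<omega>(u, e\<^sub>j) = - (- 1)\<^sup>j u\<^bsub>\<pi>(j)\<^esub>\<close> with \<open>\<pi> = swap_pair\<close>.\<close>

definition transv :: "nat \<Rightarrow> (nat \<Rightarrow> 'a::comm_ring_1) \<Rightarrow> (nat \<Rightarrow> 'a) \<Rightarrow> 'a \<Rightarrow> 'a mat" where
  "transv n u v c = mat (2 * n) (2 * n) (\<lambda>(i, j). (if i = j then 1 else 0)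
     - c * (- 1) ^ j * (u i * v (swap_pair j) + v i * u (swap_pair j)))"

lemma sform_skew: "sform n x y = - sform n y x"
proof -
  have "sform n x y = (\<Sum>i<2 * n. (- 1) ^ swap_pair i * x (swap_pair i) * y (swap_pair (swap_pair i)))"
    unfolding sform_def by (rule sum_swap_pair[symmetric])
  also have "\<dots> = - sform n y x"
    by (simp add: sform_def sum_negf[symmetric] mult_ac)
  finally show ?thesis .
qed

text \<open>Skew-symmetry says that twice the value is 0, and the inverse \<open>h\<close> of 2
  removes the factor.\<close>

lemma sform_self:
  assumes "(2::'a::comm_ring_1) dvd 1"
  shows "sform n x (x :: nat \<Rightarrow> 'a) = 0"
proof -
  obtain h :: 'a where h: "1 = 2 * h" using assms by (auto elim: dvdE)
  have "sform n x x + sform n x x = 0"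
    using sform_skew[of n x x] by (simp add: eq_neg_iff_add_eq_0)
  then have "2 * sform n x x = 0" by simp
  then have "(2 * h) * sform n x x = 0" by (metis mult.assoc mult.commute mult_zero_left)
  then show ?thesis by (simp flip: h)
qed

lemma sform_cong:
  assumes "\<And>i. i < 2 * n \<Longrightarrow> x i = x' i" "\<And>i. i < 2 * n \<Longrightarrow> y i = y' i"
  shows "sform n x y = sform n x' y'"
  unfolding sform_def using assms by (intro sum.cong) auto

lemma sform_add:
  "sform n (\<lambda>i. x i + y i) z = sform n x z + sform n y z"
  "sform n z (\<lambda>i. x i + y i) = sform n z x + sform n z y"
  by (simp_all add: sform_def algebra_simps sum.distrib)

lemma sform_scale:
  "sform n (\<lambda>i. a * x i) z = a * sform n x z"
  "sform n z (\<lambda>i. a * x i) = a * sform n z x"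
  by (simp_all add: sform_def sum_distrib_left mult_ac)

lemma sform_sum:
  "sform n (\<lambda>k. \<Sum>i\<in>S. f i k) z = (\<Sum>i\<in>S. sform n (f i) z)"
  "sform n z (\<lambda>k. \<Sum>i\<in>S. f i k) = (\<Sum>i\<in>S. sform n z (f i))"
  by (induction S rule: infinite_finite_induct)
    (simp_all add: sform_add, simp_all add: sform_def)

section \<open>Transvections\<close>

lemma transv_carrier [simp]: "transv n u v c \<in> carrier_mat (2 * n) (2 * n)"
  by (simp add: transv_def)

lemma transv_dim [simp]: "dim_row (transv n u v c) = 2 * n" "dim_col (transv n u v c) = 2 * n"
  by (simp_all add: transv_def)

lemma act_one: "act n (1\<^sub>m (2 * n)) x = (\<lambda>i. if i < 2 * n then x i else 0)"
  by (auto simp: act_def fun_eq_iff if_distrib[of "\<lambda>a. a * _"] cong: if_cong)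

lemma act_mult:
  assumes "dim_row A = 2 * n" "dim_col A = 2 * n" "dim_row B = 2 * n" "dim_col B = 2 * n"
  shows "act n (A * B) x = act n A (act n B x)"
proof
  fix i
  show "act n (A * B) x i = act n A (act n B x) i"
  proof (cases "i < 2 * n")
    case True
    have "(\<Sum>j<2 * n. (A * B) $$ (i, j) * x j)
        = (\<Sum>j<2 * n. \<Sum>k<2 * n. A $$ (i, k) * B $$ (k, j) * x j)"
      using assms True
      by (auto simp: scalar_prod_def sum_distrib_right lessThan_atLeast0 intro!: sum.cong)
    also have "\<dots> = (\<Sum>k<2 * n. A $$ (i, k) * (\<Sum>j<2 * n. B $$ (k, j) * x j))"
      by (subst sum.swap) (simp add: sum_distrib_left mult_ac)
    finally show ?thesis using True by (simp add: act_def)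
  qed (simp add: act_def)
qed

text \<open>Unit vectors pick out columns. Identities between products of transvections can thus be
  checked on vectors, where they become polynomial identities in values of the form.\<close>

lemma act_eqI:
  assumes "dim_row A = 2 * n" "dim_col A = 2 * n" "dim_row B = 2 * n" "dim_col B = 2 * n"
    and eq: "\<And>x i. i < 2 * n \<Longrightarrow> act n A x i = act n B x i"
  shows "A = B"
proof (rule eq_matI)
  fix i j assume "i < dim_row B" "j < dim_col B"
  with assms have ij: "i < 2 * n" "j < 2 * n" by auto
  have *: "act n M (\<lambda>k. if k = j then 1 else 0) i = M $$ (i, j)" for M :: "'a mat"
    using ij by (simp add: act_def if_distrib[of "\<lambda>a. _ * a"] cong: if_cong)
  show "A $$ (i, j) = B $$ (i, j)"
    using eq[OF ij(1), of "\<lambda>k. if k = j then 1 else 0"] by (simp add: *)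
qed (use assms in auto)

lemma act_transv:
  "act n (transv n u v c) x i =
     (if i < 2 * n then x i + c * (u i * sform n v x + v i * sform n u x) else 0)"
proof (cases "i < 2 * n")
  case True
  have *: "sform n w x = - (\<Sum>j<2 * n. (- 1) ^ j * w (swap_pair j) * x j)" for w
    unfolding sform_def by (subst sum_swap_pair[symmetric]) (simp add: sum_negf)
  have "act n (transv n u v c) x i =
      (\<Sum>j<2 * n. (if i = j then x j else 0) - c * (- 1) ^ j * (u i * v (swap_pair j) + v i * u (swap_pair j)) * x j)"
    using True by (auto simp: act_def transv_def algebra_simps intro!: sum.cong)
  also have "\<dots> = x i - (\<Sum>j<2 * n. c * (- 1) ^ j * (u i * v (swap_pair j) + v i * u (swap_pair j)) * x j)"
    using True by (simp add: sum_subtractf)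
  also have "\<dots> = x i + c * (u i * sform n v x + v i * sform n u x)"
    by (simp add: * sum_distrib_left sum.distrib algebra_simps)
  finally show ?thesis using True by simp
qed (simp add: act_def)

lemma sform_act_transv:
  "sform n w (act n (transv n u v c) x) =
     sform n w x + c * (sform n w u * sform n v x + sform n w v * sform n u x)"
proof -
  have "sform n w (act n (transv n u v c) x) =
    sform n w (\<lambda>i. x i + (c * sform n v x * u i + c * sform n u x * v i))"
    by (rule sform_cong) (auto simp: act_transv algebra_simps)
  also have "\<dots> = sform n w x + c * (sform n w u * sform n v x + sform n w v * sform n u x)"
    unfolding sform_add sform_scale by (simp add: algebra_simps)
  finally show ?thesis .
qed

lemmas act_simps = act_mult[of _ n _ for n] act_transv sform_act_transv act_one

section \<open>Identities between transvections\<close>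

lemma transv_commute: "transv n u v c = transv n v u c"
  by (rule act_eqI[of _ n]) (auto simp: act_transv algebra_simps)

lemma transv_scale: "transv n (\<lambda>i. s * u i) v c = transv n u v (s * c)"
  by (rule act_eqI[of _ n]) (auto simp: act_transv sform_scale algebra_simps)

lemma transv_zero: "transv n u v 0 = 1\<^sub>m (2 * n)"
  by (rule act_eqI[of _ n]) (auto simp: act_transv act_one)

text \<open>Every term with the factor \<open>c * d\<close> contains \<open>sform n u u\<close>,
  \<open>sform n v v\<close> or the form of \<open>u\<close> and \<open>v\<close>, hence
  vanishes.\<close>

lemma transv_add:
  assumes "sform n u u = 0" "sform n v v = 0" "sform n u v = 0"
  shows "transv n u v c * transv n u v d = transv n u v (c + d)"
  using assms sform_skew[of n v u]
  by (intro act_eqI[of _ n]) (auto simp: act_simps algebra_simps)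

text \<open>The product of the first two factors moves \<open>x\<close> too far by
  \<open>c * c * sform n u v * sform n w x\<close> times \<open>w\<close>. The factor
  \<open>transv n w w e\<close> adds \<open>2 * e * sform n w x\<close> times \<open>w\<close>,
  which cancels this.\<close>

lemma transv_add_vec:
  assumes e: "2 * e = - (c * c * sform n u v)"
    and 0: "sform n u w = 0" "sform n v w = 0" "sform n w w = 0"
  shows "transv n (\<lambda>i. u i + v i) w c = transv n u w c * transv n v w c * transv n w w e"
proof -
  have 1: "sform n w u = 0" "sform n w v = 0"
    using 0 sform_skew[of n w u] sform_skew[of n w v] by auto
  \<comment> \<open>The equation for \<open>2 * e\<close>, nested so that it can rewrite products
    that have been sorted by \<open>algebra_simps\<close>.\<close>
  have 2: "e * (a * (2 * b)) = - (c * (c * (a * (sform n u v * b))))" for a b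
  proof -
    have "e * (a * (2 * b)) = 2 * e * (a * b)" by (simp add: mult_ac)
    then show ?thesis unfolding e by (simp add: mult_ac)
  qed
  show ?thesis
    using 0 1
    by (intro act_eqI[of _ n]) (simp_all add: act_simps sform_add algebra_simps 2)
qed

text \<open>The vectors \<open>a\<close> and \<open>b\<close> are orthogonal to all four vectors, so
  the only pairing that survives is that of \<open>p\<close> with \<open>q\<close>. By
  \<open>transv_add\<close> the factors with negated parameters are inverses, so the right side is a
  commutator.\<close>

lemma transv_commutator:
  assumes "sform n a p = 0" "sform n a q = 0" "sform n b p = 0" "sform n b q = 0"
    and "sform n a b = 0" "sform n p p = 0" "sform n q q = 0" "sform n a a = 0" "sform n b b = 0"
  shows "transv n a b (c * d * sform n p q) =
    transv n p a c * transv n q b d * transv n p a (- c) * transv n q b (- d)"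
proof -
  have 0: "sform n p a = 0" "sform n q a = 0" "sform n p b = 0" "sform n q b = 0" "sform n b a = 0"
    using assms(1-5) sform_skew[of n p a] sform_skew[of n q a] sform_skew[of n p b]
      sform_skew[of n q b] sform_skew[of n b a] by auto
  show ?thesis
    using assms 0 sform_skew[of n q p]
    by (intro act_eqI[of _ n]) (auto simp: act_simps algebra_simps)
qed

text \<open>Polarization: the mixed terms in \<open>u\<close> and \<open>v\<close> occur twice and
  form the last factor. Orthogonality makes the displacements of the three factors simply add
  up.\<close>

lemma transv_add_self:
  assumes "sform n u v = 0" "sform n u u = 0" "sform n v v = 0"
  shows "transv n (\<lambda>i. u i + v i) (\<lambda>i. u i + v i) c =
    transv n u u c * transv n v v c * transv n u v (2 * c)"
  using assms sform_skew[of n v u]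
  by (intro act_eqI[of _ n]) (auto simp: act_simps sform_add algebra_simps)

section \<open>The symplectic group\<close>

text \<open>Entry \<open>(i, j)\<close> of the left side is the form of columns \<open>i\<close> and
  \<open>j\<close> of \<open>A\<close>; bilinearity passes from unit vectors to all vectors.\<close>

lemma preserves_psi_iff:
  assumes A: "A \<in> carrier_mat (2 * n) (2 * n)"
  shows "transpose_mat A * psi n * A = psi n \<longleftrightarrow>
    (\<forall>x y. sform n (act n A x) (act n A y) = sform n x y)"
proof -
  have idx: "(transpose_mat A * psi n * A) $$ (i, j) =
      sform n (\<lambda>k. A $$ (k, i)) (\<lambda>k. A $$ (k, j))" if "i < 2 * n" "j < 2 * n" for i j
  proof -
    have "(transpose_mat A * psi n) $$ (i, l) = (\<Sum>k<2 * n. if l = swap_pair k then (- 1) ^ k * A $$ (k, i) else 0)"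
      if "l < 2 * n" for l
      using A that \<open>i < 2 * n\<close> carrier_matD[OF psi_carrier[of n, where ?'a = 'a]]
      by (auto simp: scalar_prod_def lessThan_atLeast0 psi_index intro!: sum.cong)
    moreover have "(M * A) $$ (i, j) = (\<Sum>l<2 * n. M $$ (i, l) * A $$ (l, j))"
      if "dim_row M = 2 * n" "dim_col M = 2 * n" for M :: "'a mat"
      using A that \<open>i < 2 * n\<close> \<open>j < 2 * n\<close> by (simp add: scalar_prod_def lessThan_atLeast0)
    ultimately have "(transpose_mat A * psi n * A) $$ (i, j) =
        (\<Sum>l<2 * n. (\<Sum>k<2 * n. if l = swap_pair k then (- 1) ^ k * A $$ (k, i) else 0) * A $$ (l, j))"
      using A carrier_matD[OF psi_carrier[of n, where ?'a = 'a]] by simp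
    also have "\<dots> = (\<Sum>l<2 * n. \<Sum>k<2 * n. if l = swap_pair k then (- 1) ^ k * A $$ (k, i) * A $$ (l, j) else 0)"
      by (auto simp: sum_distrib_right intro!: sum.cong)
    also have "\<dots> = sform n (\<lambda>k. A $$ (k, i)) (\<lambda>k. A $$ (k, j))"
      by (subst sum.swap) (simp add: sform_def)
    finally show ?thesis .
  qed
  define u :: "nat \<Rightarrow> nat \<Rightarrow> 'a" where "u j = (\<lambda>k. if k = j then 1 else 0)" for j
  have u: "sform n (u i) (u j) = psi n $$ (i, j)" if "i < 2 * n" "j < 2 * n" for i j
  proof -
    have "sform n (u i) (u j) = (\<Sum>k<2 * n. if k = i then (- 1) ^ i * u j (swap_pair i) else 0)"
      unfolding sform_def u_def by (intro sum.cong) auto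
    then show ?thesis using that by (auto simp: psi_index u_def)
  qed
  \<comment> \<open>Bilinear expansion along a family \<open>f\<close>, used both for the columns of
    \<open>A\<close> and for the unit vectors \<open>u\<close>.\<close>
  have expand: "sform n (\<lambda>k. if k < 2 * n then \<Sum>i<2 * n. f i k * x i else 0)
      (\<lambda>k. if k < 2 * n then \<Sum>i<2 * n. f i k * y i else 0)
    = (\<Sum>i<2 * n. \<Sum>j<2 * n. x i * y j * sform n (f i) (f j))" for f x y
  proof -
    have "sform n (\<lambda>k. if k < 2 * n then \<Sum>i<2 * n. f i k * x i else 0)
        (\<lambda>k. if k < 2 * n then \<Sum>i<2 * n. f i k * y i else 0)
      = sform n (\<lambda>k. \<Sum>i<2 * n. x i * f i k) (\<lambda>k. \<Sum>i<2 * n. y i * f i k)"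
      by (rule sform_cong) (simp_all add: mult.commute)
    then show ?thesis by (simp add: sform_sum sform_scale sum_distrib_left mult_ac)
  qed
  show ?thesis
  proof
    assume eq: "transpose_mat A * psi n * A = psi n"
    show "\<forall>x y. sform n (act n A x) (act n A y) = sform n x y"
    proof (intro allI)
      fix x y
      have "sform n (act n A x) (act n A y) = (\<Sum>i<2 * n. \<Sum>j<2 * n. x i * y j * psi n $$ (i, j))"
        unfolding act_def expand[of "\<lambda>i k. A $$ (k, i)"] by (simp add: idx[symmetric] eq)
      also have "\<dots> = sform n (\<lambda>k. if k < 2 * n then \<Sum>i<2 * n. u i k * x i else 0)
          (\<lambda>k. if k < 2 * n then \<Sum>i<2 * n. u i k * y i else 0)"
        unfolding expand by (simp add: u)
      also have "\<dots> = sform n x y"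
        by (rule sform_cong) (auto simp: u_def if_distrib[of "\<lambda>a. a * _"] cong: if_cong)
      finally show "sform n (act n A x) (act n A y) = sform n x y" .
    qed
  next
    assume *: "\<forall>x y. sform n (act n A x) (act n A y) = sform n x y"
    show "transpose_mat A * psi n * A = psi n"
    proof (rule eq_matI)
      fix i j assume "i < dim_row (psi n :: 'a mat)" "j < dim_col (psi n :: 'a mat)"
      then have ij: "i < 2 * n" "j < 2 * n"
        using carrier_matD[OF psi_carrier[of n, where ?'a = 'a]] by auto
      have "sform n (\<lambda>k. A $$ (k, i)) (\<lambda>k. A $$ (k, j)) = sform n (act n A (u i)) (act n A (u j))"
        using ij by (intro sform_cong) (auto simp: act_def u_def if_distrib[of "\<lambda>a. _ * a"] cong: if_cong)
      then show "(transpose_mat A * psi n * A) $$ (i, j) = psi n $$ (i, j)"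
        using ij * u by (simp add: idx)
    qed (use A carrier_matD[OF psi_carrier[of n, where ?'a = 'a]] in auto)
  qed
qed

text \<open>The square of \<open>psi n\<close> is minus the identity of even size, which has
  determinant 1. So the determinant of \<open>psi n\<close> can be cancelled without being
  computed.\<close>

lemma det_psi_square: "det (psi n :: 'a::comm_ring_1 mat) * det (psi n :: 'a mat) = 1"
proof -
  have "psi n * psi n = - 1 \<cdot>\<^sub>m (1\<^sub>m (2 * n) :: 'a mat)"
  proof (rule eq_matI)
    fix i j assume "i < dim_row (- 1 \<cdot>\<^sub>m (1\<^sub>m (2 * n) :: 'a mat))" "j < dim_col (- 1 \<cdot>\<^sub>m (1\<^sub>m (2 * n) :: 'a mat))"
    then have ij: "i < 2 * n" "j < 2 * n" by auto
    then have "(psi n * psi n) $$ (i, j) = (\<Sum>k<2 * n. psi n $$ (i, k) * (psi n $$ (k, j) :: 'a))"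
      using carrier_matD[OF psi_carrier[of n, where ?'a = 'a]]
      by (simp add: scalar_prod_def lessThan_atLeast0)
    also have "\<dots> = (\<Sum>k<2 * n. if k = swap_pair i then (- 1) ^ i * psi n $$ (k, j) else 0)"
      using ij by (intro sum.cong) (auto simp: psi_index)
    also have "\<dots> = (- 1 \<cdot>\<^sub>m (1\<^sub>m (2 * n) :: 'a mat)) $$ (i, j)"
      using ij by (auto simp: psi_index simp flip: power_add mult_2)
    finally show "(psi n * psi n) $$ (i, j) = (- 1 \<cdot>\<^sub>m (1\<^sub>m (2 * n) :: 'a mat)) $$ (i, j)" .
  qed (use carrier_matD[OF psi_carrier[of n, where ?'a = 'a]] in auto)
  then have "det (psi n) * det (psi n) = det ((-1) \<cdot>\<^sub>m (1\<^sub>m (2 * n) :: 'a mat))"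
    by (subst det_mult[symmetric, of _ "2 * n"]) simp_all
  also have "\<dots> = 1" by (simp add: det_smult)
  finally show ?thesis .
qed

lemma det_square_of_preserves_psi:
  assumes A: "A \<in> carrier_mat (2 * n) (2 * n)" and eq: "transpose_mat A * psi n * A = psi n"
  shows "det A * det A = 1"
proof -
  have "det (transpose_mat A * psi n * A) = det A * det (psi n) * det A"
    using A by (simp add: det_mult[of _ "2 * n"] det_transpose)
  then have "det A * det (psi n) * det A = det (psi n)" by (simp add: eq)
  then have "det A * det A * (det (psi n) * det (psi n)) = det (psi n) * det (psi n)"
    by (simp add: mult_ac)
  then show ?thesis by (simp add: det_psi_square)
qed

lemma Sp_simps [simp]:
  "monoid.mult (Sp n) = (*)" "one (Sp n) = 1\<^sub>m (2 * n)"
  by (simp_all add: Sp_def)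

lemma in_Sp_iff:
  "A \<in> carrier (Sp n) \<longleftrightarrow> A \<in> carrier_mat (2 * n) (2 * n) \<and> det A = 1 \<and>
    (\<forall>x y. sform n (act n A x) (act n A y) = sform n x y)"
  unfolding Sp_def by (auto simp: preserves_psi_iff)

text \<open>The adjugate is the inverse because the determinant is 1. It preserves the form because
  \<open>A\<close> does and \<open>A * adj_mat A\<close> is the identity.\<close>

lemma group_Sp: "group (Sp n :: 'a::comm_ring_1 mat monoid)"
proof (rule groupI)
  fix A :: "'a mat" assume A: "A \<in> carrier (Sp n)"
  then have Ac: "A \<in> carrier_mat (2 * n) (2 * n)" by (simp add: in_Sp_iff)
  note adj = adj_mat[OF Ac]
  have d: "det A = 1" using A by (simp add: in_Sp_iff)
  have 1: "A * adj_mat A = 1\<^sub>m (2 * n)" "adj_mat A * A = 1\<^sub>m (2 * n)"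
    using adj d by auto
  have "det (A * adj_mat A) = 1" by (simp add: 1)
  then have "det (adj_mat A) = 1" using d by (simp add: det_mult[OF Ac adj(1)])
  moreover have "sform n (act n (adj_mat A) x) (act n (adj_mat A) y) = sform n x y" for x y
  proof -
    have "sform n (act n (adj_mat A) x) (act n (adj_mat A) y) =
      sform n (act n (A * adj_mat A) x) (act n (A * adj_mat A) y)"
      using A carrier_matD[OF Ac] carrier_matD[OF adj(1)] by (simp add: act_mult in_Sp_iff)
    also have "\<dots> = sform n x y"
      unfolding 1 act_one by (rule sform_cong) auto
    finally show ?thesis .
  qed
  ultimately have "adj_mat A \<in> carrier (Sp n)" using adj by (simp add: in_Sp_iff)
  then show "\<exists>B\<in>carrier (Sp n). B \<otimes>\<^bsub>Sp n\<^esub> A = \<one>\<^bsub>Sp n\<^esub>" using 1 by auto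
next
  show "\<one>\<^bsub>Sp n\<^esub> \<in> carrier (Sp n :: 'a mat monoid)"
    by (auto simp: in_Sp_iff act_one intro: sform_cong)
qed (auto simp: in_Sp_iff act_mult det_mult[of _ "2 * n"] assoc_mult_mat[of _ "2 * n" "2 * n"])

text \<open>The terms linear in \<open>c\<close> cancel by skew-symmetry; those quadratic in
  \<open>c\<close> vanish because \<open>u\<close> and \<open>v\<close> span an isotropic
  space.\<close>

lemma sform_act_act_transv:
  assumes "sform n u v = 0" "sform n u u = 0" "sform n v v = 0"
  shows "sform n (act n (transv n u v c) x) (act n (transv n u v c) y) = sform n x y"
proof -
  let ?T = "act n (transv n u v c)"
  have l: "sform n (?T x) w = sform n x w + c * (sform n v x * sform n u w + sform n u x * sform n v w)" for w
    by (subst (1 2 4 6) sform_skew) (simp add: sform_act_transv sform_skew[of n _ w] algebra_simps)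
  show ?thesis using assms sform_skew[of n v u] sform_skew[of n x u] sform_skew[of n x v]
    by (simp add: l sform_act_transv algebra_simps)
qed

lemma transv_in_Sp:
  fixes c :: "'a::comm_ring_1"
  assumes two: "(2 :: 'a) dvd 1" and uv: "sform n u v = 0"
  shows "transv n u v c \<in> carrier (Sp n)"
proof -
  obtain h :: 'a where h: "1 = 2 * h" using two by (auto elim: dvdE)
  \<comment> \<open>preserving the form only gives \<open>det\<^sup>2 = 1\<close>, but halving \<open>c\<close> makes the matrix a square\<close>
  note uv = uv sform_self[OF two]
  have "c = h * c + h * c" using h by (metis distrib_right mult_1 mult_2)
  then have "transv n u v c = transv n u v (h * c) * transv n u v (h * c)"
    using uv by (simp add: transv_add)
  then have "det (transv n u v c) = det (transv n u v (h * c)) * det (transv n u v (h * c))"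
    by (simp add: det_mult[of _ "2 * n"])
  also have "\<dots> = 1"
    using uv by (intro det_square_of_preserves_psi[of _ n]) (simp_all add: preserves_psi_iff sform_act_act_transv)
  finally show ?thesis using uv by (simp add: in_Sp_iff sform_act_act_transv)
qed

section \<open>Conjugation of transvections and normality\<close>

lemma conjugate_transv:
  assumes "g \<in> carrier (Sp n)"
  shows "g \<otimes>\<^bsub>Sp n\<^esub> transv n u v c \<otimes>\<^bsub>Sp n\<^esub> inv\<^bsub>Sp n\<^esub> g = transv n (act n g u) (act n g v) c"
proof -
  interpret group "Sp n" by (rule group_Sp)
  have g: "g \<in> carrier_mat (2 * n) (2 * n)" using assms by (simp add: in_Sp_iff)
  have ginv: "inv\<^bsub>Sp n\<^esub> g \<in> carrier_mat (2 * n) (2 * n)"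
    using inv_closed[OF assms] by (simp add: in_Sp_iff)
  have "g * transv n u v c = transv n (act n g u) (act n g v) c * g"
  proof (rule act_eqI[of _ n])
    fix x i assume i: "i < 2 * n"
    have "act n g (act n (transv n u v c) x) i =
      (\<Sum>j<2 * n. g $$ (i, j) * (x j + c * (u j * sform n v x + v j * sform n u x)))"
      using i by (auto simp: act_def[of n g] act_transv)
    also have "\<dots> = act n g x i + c * (act n g u i * sform n v x + act n g v i * sform n u x)"
      using i by (simp add: act_def sum_distrib_left sum_distrib_right sum.distrib algebra_simps)
    \<comment> \<open>As \<open>g\<close> preserves the form, \<open>sform n v x\<close> equals the
      form of \<open>act n g v\<close> and \<open>act n g x\<close>, and likewise for
      \<open>u\<close>.\<close>
    finally show "act n (g * transv n u v c) x i = act n (transv n (act n g u) (act n g v) c * g) x i"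
      using i g assms by (simp add: act_simps in_Sp_iff)
  qed (use g in auto)
  then have "g * transv n u v c * inv\<^bsub>Sp n\<^esub> g = transv n (act n g u) (act n g v) c * (g * inv\<^bsub>Sp n\<^esub> g)"
    using g ginv by (simp add: assoc_mult_mat[of _ "2 * n" "2 * n"])
  then show ?thesis using r_inv[OF assms] by (simp add: right_mult_one_mat[of _ _ "2 * n"])
qed

definition transv_set :: "nat \<Rightarrow> 'a::comm_ring_1 mat set" where
  "transv_set n = {transv n u v c | u v c. sform n u v = 0}"

lemma transv_set_subset_Sp: "(2 :: 'a::comm_ring_1) dvd 1 \<Longrightarrow> (transv_set n :: 'a mat set) \<subseteq> carrier (Sp n)"
  by (auto simp: transv_set_def transv_in_Sp)

lemma normal_generate_transv_set:
  assumes "(2 :: 'a::comm_ring_1) dvd 1"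
  shows "generate (Sp n) (transv_set n :: 'a mat set) \<lhd> Sp n"
proof (rule group.normal_generateI[OF group_Sp transv_set_subset_Sp[OF assms]])
  fix h g :: "'a mat" assume "h \<in> transv_set n" and g: "g \<in> carrier (Sp n)"
  then obtain u v c where "h = transv n u v c" "sform n u v = 0" by (auto simp: transv_set_def)
  with g show "g \<otimes>\<^bsub>Sp n\<^esub> h \<otimes>\<^bsub>Sp n\<^esub> inv\<^bsub>Sp n\<^esub> g \<in> transv_set n"
    unfolding transv_set_def using conjugate_transv[OF g, of u v c]
    by (intro CollectI exI[of _ "act n g u"] exI[of _ "act n g v"] exI[of _ c]) (simp add: in_Sp_iff)
qed

section \<open>Generation by transvections between blocks\<close>

definition block_vec :: "nat \<Rightarrow> 'a \<times> 'a \<Rightarrow> nat \<Rightarrow> 'a::comm_ring_1" where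
  "block_vec k z = (\<lambda>i. if i = 2 * k then fst z else if i = 2 * k + 1 then snd z else 0)"

lemma sform_block_vec_left:
  assumes "k < n"
  shows "sform n (block_vec k z) x = fst z * x (2 * k + 1) - snd z * x (2 * k)"
proof -
  have "sform n (block_vec k z) x = (\<Sum>i\<in>{2 * k, 2 * k + 1}. (- 1) ^ i * block_vec k z i * x (swap_pair i))"
    unfolding sform_def using assms by (intro sum.mono_neutral_right) (auto simp: block_vec_def)
  then show ?thesis by (simp add: block_vec_def swap_pair_def)
qed

lemma sform_block_vec_block_vec:
  assumes "k < n"
  shows "sform n (block_vec k z) (block_vec l w) = (if k = l then fst z * snd w - snd z * fst w else 0)"
  unfolding sform_block_vec_left[OF assms] by (auto simp: block_vec_def)

text \<open>Here \<open>G\<close> stands for the group generated by the given elements. Closure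
  under products suffices, since negating the parameter inverts the transvections in question. The
  assumption \<open>unit\<close> says that \<open>p\<close> and \<open>q\<close> form a basis of the
  plane of pairs.\<close>

context
  fixes n :: nat and G :: "'a::comm_ring_1 mat set" and p q :: "'a \<times> 'a"
  assumes two: "(2 :: 'a) dvd 1"
    and mult_closed: "\<And>A B. A \<in> G \<Longrightarrow> B \<in> G \<Longrightarrow> A * B \<in> G"
    and unit: "(fst p * snd q - snd p * fst q) dvd 1"
begin

lemma block_vec_basis:
  obtains s t where "\<And>k. block_vec k a = (\<lambda>i. s * block_vec k p i + t * block_vec k q i)"
proof -
  obtain d where d: "1 = (fst p * snd q - snd p * fst q) * d" using unit by (auto elim: dvdE)
  \<comment> \<open>Cramer's rule, with \<open>d\<close> the inverse of the determinant.\<close>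
  define s where "s = d * (fst a * snd q - snd a * fst q)"
  define t where "t = d * (fst p * snd a - snd p * fst a)"
  have "s * fst p + t * fst q = ((fst p * snd q - snd p * fst q) * d) * fst a"
    "s * snd p + t * snd q = ((fst p * snd q - snd p * fst q) * d) * snd a"
    by (simp_all add: s_def t_def algebra_simps)
  then have "s * fst p + t * fst q = fst a" "s * snd p + t * snd q = snd a" by (simp_all flip: d)
  then have "block_vec k a = (\<lambda>i. s * block_vec k p i + t * block_vec k q i)" for k
    by (auto simp: block_vec_def)
  then show thesis by (rule that)
qed

text \<open>Scalars move into the parameter, \<open>transv_add_vec\<close> splits the sum, and the
  third assumption supplies its correction factor. Solving for that factor's parameter needs the
  half \<open>h\<close>.\<close>

lemma transv_add_vec_closed:
  assumes "\<And>c. transv n u w c \<in> G" "\<And>c. transv n v w c \<in> G" "\<And>c. transv n w w c \<in> G"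
    and "sform n u w = 0" "sform n v w = 0"
  shows "transv n (\<lambda>i. s * u i + t * v i) w c \<in> G"
proof -
  obtain h :: 'a where h: "1 = 2 * h" using two by (auto elim: dvdE)
  let ?e = "- (h * c * c * sform n (\<lambda>i. s * u i) (\<lambda>i. t * v i))"
  have "2 * ?e = - ((2 * h) * (c * c * sform n (\<lambda>i. s * u i) (\<lambda>i. t * v i)))"
    by (simp only: mult_ac mult_minus_right)
  then have "2 * ?e = - (c * c * sform n (\<lambda>i. s * u i) (\<lambda>i. t * v i))"
    by (simp flip: h)
  from transv_add_vec[OF this, of w] assms show ?thesis
    by (auto simp: transv_scale sform_scale sform_self[OF two] intro!: mult_closed)
qed

text \<open>Block \<open>k\<close> serves as an intermediary: \<open>a\<close> and \<open>b\<close>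
  vanish there, hence are orthogonal to it. Taking for \<open>d\<close> the inverse of the form of
  the two basis vectors gives the commutator the parameter \<open>c\<close>.\<close>

lemma transv_commutator_closed:
  assumes k: "k < n"
    and G: "\<And>c. transv n (block_vec k p) a c \<in> G" "\<And>c. transv n (block_vec k q) b c \<in> G"
    and ab: "sform n a b = 0" "a (2 * k) = 0" "a (2 * k + 1) = 0" "b (2 * k) = 0" "b (2 * k + 1) = 0"
  shows "transv n a b c \<in> G"
proof -
  obtain d where d: "1 = (fst p * snd q - snd p * fst q) * d" using unit by (auto elim: dvdE)
  have pq: "sform n (block_vec k p) (block_vec k q) = fst p * snd q - snd p * fst q"
    using k by (simp add: sform_block_vec_block_vec)
  have 0: "sform n x (block_vec k z) = 0" if "x (2 * k) = 0" "x (2 * k + 1) = 0" for x z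
    using that sform_block_vec_left[OF k, of z x] sform_skew[of n x] by simp
  have "c = c * d * sform n (block_vec k p) (block_vec k q)"
    using d unfolding pq by (simp add: mult_ac)
  moreover have "transv n a b (c * d * sform n (block_vec k p) (block_vec k q)) \<in> G"
    using ab by (subst transv_commutator) (auto simp: 0 sform_self[OF two] intro!: mult_closed G)
  ultimately show ?thesis by simp
qed

text \<open>The two blocks help each other in turn, as additivity in one block needs the correction
  factors of the other. Commutators through block \<open>k\<close> give these for basis vectors of
  block \<open>l\<close>, which frees the vector in block \<open>k\<close>. Commutators through
  block \<open>l\<close> then give them for block \<open>k\<close>, which frees the vector in block
  \<open>l\<close>.\<close>

lemma block_pair_closed:
  assumes kl: "k < n" "l < n" "k \<noteq> l"
    and G: "\<And>x y c. x \<in> {p, q} \<Longrightarrow> y \<in> {p, q} \<Longrightarrow> transv n (block_vec k x) (block_vec l y) c \<in> G"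
  shows "transv n (block_vec k a) (block_vec l b) c \<in> G"
    and "transv n (block_vec k a) (block_vec k a) c \<in> G"
    and "transv n (block_vec l b) (block_vec l b) c \<in> G"
proof -
  have zero: "block_vec k z (2 * l) = 0" "block_vec k z (Suc (2 * l)) = 0"
    "block_vec l z (2 * k) = 0" "block_vec l z (Suc (2 * k)) = 0" for z :: "'a \<times> 'a"
    using kl by (auto simp: block_vec_def)
  have orth: "sform n (block_vec k z) (block_vec l w) = 0" "sform n (block_vec l w) (block_vec k z) = 0"
    for z w :: "'a \<times> 'a"
    using kl by (simp_all add: sform_block_vec_block_vec)
  have yy: "transv n (block_vec l y) (block_vec l y) c \<in> G" if "y \<in> {p, q}" for y c
    by (rule transv_commutator_closed[OF kl(1)]) (use that in \<open>simp_all add: G zero sform_self[OF two]\<close>)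
  have ay: "transv n (block_vec k a) (block_vec l y) c \<in> G" if "y \<in> {p, q}" for a y c
  proof -
    obtain s t where "block_vec k a = (\<lambda>i. s * block_vec k p i + t * block_vec k q i)"
      using block_vec_basis by blast
    moreover have "transv n (\<lambda>i. s * block_vec k p i + t * block_vec k q i) (block_vec l y) c \<in> G"
      by (rule transv_add_vec_closed) (use that in \<open>auto intro!: G yy orth\<close>)
    ultimately show ?thesis by (simp only:)
  qed
  have aa: "transv n (block_vec k a) (block_vec k a) c \<in> G" for a c
    by (rule transv_commutator_closed[OF kl(2)])
      (simp_all add: transv_commute[of n "block_vec l _"] ay zero sform_self[OF two])
  have ab: "transv n (block_vec k a) (block_vec l b) c \<in> G" for a b c
  proof -
    obtain s t where "block_vec l b = (\<lambda>i. s * block_vec l p i + t * block_vec l q i)"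
      using block_vec_basis by blast
    moreover have "transv n (\<lambda>i. s * block_vec l p i + t * block_vec l q i) (block_vec k a) c \<in> G"
      by (rule transv_add_vec_closed) (simp_all add: transv_commute[of n "block_vec l _"] ay aa orth)
    ultimately show ?thesis by (subst transv_commute) (simp only:)
  qed
  show "transv n (block_vec k a) (block_vec l b) c \<in> G" by (rule ab)
  show "transv n (block_vec k a) (block_vec k a) c \<in> G" by (rule aa)
  show "transv n (block_vec l b) (block_vec l b) c \<in> G"
    by (rule transv_commutator_closed[OF kl(1)]) (simp_all add: ab zero sform_self[OF two])
qed

lemma transv_set_subset:
  assumes n: "n \<ge> 2"
    and G: "\<And>k x y c. k \<in> {1..<n} \<Longrightarrow> x \<in> {p, q} \<Longrightarrow> y \<in> {p, q} \<Longrightarrow>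
      transv n (block_vec 0 x) (block_vec k y) c \<in> G"
  shows "transv_set n \<subseteq> G"
proof -
  have first: "transv n (block_vec 0 a) (block_vec k b) c \<in> G"
    "transv n (block_vec 0 a) (block_vec 0 a) c \<in> G"
    "transv n (block_vec k b) (block_vec k b) c \<in> G" if "k \<in> {1..<n}" for a b c k
    by (rule block_pair_closed[of 0 k]; use that n G in simp)+
  \<comment> \<open>Because \<open>n\<close> is at least 2, block 1 is available as a partner of
    block 0.\<close>
  have self: "transv n (block_vec k a) (block_vec k a) c \<in> G" if "k < n" for k a c
    using first(2)[of 1] first(3)[of k] that n by (cases "k = 0") simp_all
  \<comment> \<open>Two blocks other than block 0 are linked by commutators through block 0.\<close>
  have pair: "transv n (block_vec k a) (block_vec l b) c \<in> G" if kl: "k < l" "l < n" for k l a b c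
  proof (cases "k = 0")
    case False
    have zero: "block_vec m z 0 = 0" "block_vec m z (Suc 0) = 0" if "m \<noteq> 0" for m and z :: "'a \<times> 'a"
      using that by (simp_all add: block_vec_def)
    show ?thesis
      by (rule transv_commutator_closed[of 0])
        (use kl False in \<open>simp_all add: first(1) zero sform_block_vec_block_vec\<close>)
  qed (use kl first in auto)
  \<comment> \<open>The restriction of \<open>v\<close> to its first \<open>m\<close> blocks.
    Inductions on \<open>m\<close> start at the zero vector, and \<open>m = n\<close> covers every
    coordinate that matters.\<close>
  define part :: "nat \<Rightarrow> (nat \<Rightarrow> 'a) \<Rightarrow> nat \<Rightarrow> 'a" where
    "part m v = (\<lambda>i. if i < 2 * m then v i else 0)" for m v
  have part_Suc: "part (Suc m) v = (\<lambda>i. part m v i + block_vec m (v (2 * m), v (2 * m + 1)) i)" for m v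
    by (auto simp: part_def block_vec_def less_Suc_eq)
  have orth: "sform n (part m v) (block_vec l b) = 0" if "m \<le> l" "l < n" for m l v b
    using that sform_block_vec_left[of l n b "part m v"] sform_skew[of n "part m v"]
    by (simp add: part_def)
  have one: "1\<^sub>m (2 * n) \<in> G" using first(2)[of 1 _ 0] n by (simp add: transv_zero)
  \<comment> \<open>The zero vector \<open>part 0 v\<close> is 0 times itself, and this scalar moves
    into the parameter.\<close>
  have transv_part_0: "transv n (part 0 v) w c = 1\<^sub>m (2 * n)" for v w c
    using transv_scale[of n 0 "part 0 v" w c] by (simp add: part_def transv_zero)
  have part_block: "transv n (part m v) (block_vec l b) c \<in> G" if "m \<le> l" "l < n" for m l v b c
    using that
  proof (induction m arbitrary: c)
    case 0
    show ?case by (simp add: transv_part_0 one)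
  next
    case (Suc m)
    then show ?case
      using transv_add_vec_closed[of "part m v" "block_vec l b" "block_vec m (v (2 * m), v (2 * m + 1))" 1 1 c]
        pair[of m l] self[of l] orth[of m l]
      by (simp add: part_Suc sform_block_vec_block_vec)
  qed
  have part_part: "transv n (part m v) (part m v) c \<in> G" if "m \<le> n" for m v c
    using that
  proof (induction m arbitrary: c)
    case 0
    show ?case by (simp add: transv_part_0 one)
  next
    case (Suc m)
    then show ?case
      unfolding part_Suc
      by (subst transv_add_self) (auto simp: orth sform_self[OF two] intro!: mult_closed self part_block)
  qed
  have self': "transv n v v c \<in> G" for v c
  proof -
    have "transv n v v c = transv n (part n v) (part n v) c"
      by (rule eq_matI) (auto simp: transv_def part_def)
    then show ?thesis using part_part[of n] by simp
  qed
  show ?thesis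
  proof
    fix A :: "'a mat" assume "A \<in> transv_set n"
    then obtain u v c where A: "A = transv n u v c" "sform n u v = 0" by (auto simp: transv_set_def)
    obtain h :: 'a where h: "1 = 2 * h" using two by (auto elim: dvdE)
    let ?w = "\<lambda>i. u i + v i"
    \<comment> \<open>Half of \<open>c\<close>, because polarization turns the parameter
      \<open>d\<close> at \<open>u + v\<close> into \<open>2 * d\<close> for the mixed term.\<close>
    define d where "d = h * c"
    have "2 * d = (2 * h) * c" by (simp only: d_def mult.assoc)
    then have c: "c = 2 * d" by (simp flip: h)
    have "A = transv n u u (- d) * transv n v v (- d) * transv n ?w ?w d"
      using A(2) sform_skew[of n v u] unfolding A(1) c
      by (intro act_eqI[of _ n])
        (simp_all add: act_simps sform_add sform_self[OF two], simp_all add: algebra_simps)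
    then show "A \<in> G" by (auto intro!: mult_closed self')
  qed
qed

end

section \<open>The generators of the two groups\<close>

text \<open>The two terms of a transvection coincide when both vectors are equal, whence the factor
  2.\<close>

lemma E_elem_0_1: "E_elem n 0 1 (2 * x) = transv n (block_vec 0 (1, 0)) (block_vec 0 (1, 0)) x"
  by (rule eq_matI) (auto simp: E_elem_def transv_def munit_def block_vec_def swap_pair_def algebra_simps)

lemma E_elem_1_0: "E_elem n 1 0 (2 * x) = transv n (block_vec 0 (0, 1)) (block_vec 0 (0, 1)) (- x)"
proof (rule eq_matI)
  have "j - Suc 0 \<noteq> Suc 0" if "odd j" for j using that by (auto elim!: oddE)
  then show "E_elem n 1 0 (2 * x) $$ (i, j) = transv n (block_vec 0 (0, 1)) (block_vec 0 (0, 1)) (- x) $$ (i, j)"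
    if "i < dim_row (transv n (block_vec 0 (0, 1)) (block_vec 0 (0, 1)) (- x))"
      "j < dim_col (transv n (block_vec 0 (0, 1)) (block_vec 0 (0, 1)) (- x))" for i j
    using that by (auto simp: E_elem_def transv_def munit_def block_vec_def swap_pair_def algebra_simps)
qed (simp_all add: E_elem_def munit_def)

text \<open>Pairing with the unit vector at \<open>swap_pair j\<close> reads off coordinate
  \<open>j\<close> up to the sign \<open>- ((- 1) ^ j)\<close>, which the parameter
  compensates.\<close>

lemma S_elem_eq_transv:
  "S_elem n i j x = transv n (\<lambda>k. if k = i then 1 else 0) (\<lambda>k. if k = swap_pair j then 1 else 0) (- ((- 1) ^ j * x))"
  by (rule eq_matI) (auto simp: S_elem_def transv_def munit_def power_add mult_ac)

text \<open>The block is \<open>c\<close> times the column \<open>u\<close> times the row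
  \<open>(- snd w, fst w)\<close>, which represents pairing with \<open>w\<close>. Block
  \<open>(k, 0)\<close> is the same expression with \<open>u\<close> and \<open>w\<close>
  exchanged.\<close>

lemma E_block_eq_transv:
  assumes k: "k \<in> {1..<n}"
  shows "E_block n k (mat_of_rows_list 2
      [[- (c * fst u * snd w), c * fst u * fst w], [- (c * snd u * snd w), c * snd u * fst w]]) =
    transv n (block_vec 0 u) (block_vec k w) c" (is "E_block n k ?X = ?T")
proof (rule eq_matI)
  fix i j assume "i < dim_row ?T" "j < dim_col ?T"
  then have ij: "i < 2 * n" "j < 2 * n" by simp_all
  obtain a r where i: "i = 2 * a + r" "r < 2"
    using div_mult_mod_eq[of i 2] by (metis mult.commute mod_less_divisor zero_less_numeral)
  obtain b t where j: "j = 2 * b + t" "t < 2"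
    using div_mult_mod_eq[of j 2] by (metis mult.commute mod_less_divisor zero_less_numeral)
  have bv: "block_vec l z (2 * m) = (if l = m then fst z else 0)"
    "block_vec l z (Suc (2 * m)) = (if l = m then snd z else 0)" for l m and z :: "'a \<times> 'a"
    by (auto simp: block_vec_def)
  define Y where "Y = mat_of_rows_list 2
    [[- (c * snd u * fst w), c * fst u * fst w], [- (c * snd u * snd w), c * fst u * snd w]]"
  have Y: "psi1 * transpose_mat ?X * psi1 = Y"
    by (rule eq_matI) (auto simp: Y_def psi1_def mat_of_rows_list_def scalar_prod_def less_2_cases_iff
      numeral_2_eq_2 less_Suc_eq)
  have "E_block n k ?X $$ (i, j) = (if a = b then 1\<^sub>m 2 else if a = 0 \<and> b = k then ?X
      else if a = k \<and> b = 0 then Y else 0\<^sub>m 2 2) $$ (r, t)"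
    using ij i j by (simp add: E_block_def of_blocks_def Y)
  \<comment> \<open>As \<open>t\<close> is 0 or 1, \<open>1 - t\<close> is the other position in the
    same block.\<close>
  moreover have "?T $$ (i, j) = (if a = b \<and> r = t then 1 else 0) - c * (- 1) ^ t *
      (block_vec 0 u (2 * a + r) * block_vec k w (2 * b + (1 - t))
        + block_vec k w (2 * a + r) * block_vec 0 u (2 * b + (1 - t)))"
  proof -
    have "i div 2 = a" "i mod 2 = r" "j div 2 = b" "j mod 2 = t" using i j by simp_all
    then have "i = j \<longleftrightarrow> a = b \<and> r = t" by (metis i(1) j(1))
    moreover have "swap_pair j = 2 * b + (1 - t)" "(- 1 :: 'a) ^ j = (- 1) ^ t"
      using j by (auto simp: swap_pair_def less_2_cases_iff power_add)
    ultimately show ?thesis using ij i(1) by (simp add: transv_def)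
  qed
  moreover have "r = 0 \<or> r = 1" "t = 0 \<or> t = 1" using i j by auto
  ultimately show "E_block n k ?X $$ (i, j) = ?T $$ (i, j)"
    using k by (elim disjE) (simp_all add: bv Y_def mat_of_rows_list_def)
qed (simp_all add: E_block_def of_blocks_def)

text \<open>Each of the four matrices is a column times a row: \<open>u\<close> is the column, and
  \<open>w\<close> is read off from the row \<open>(- snd w, fst w)\<close>. For
  \<open>mat_B\<close> that row has the opposite sign, hence the parameter
  \<open>- a\<close>.\<close>

lemma E_block_mat_eq_transv:
  assumes "k \<in> {1..<n}"
  shows "E_block n k (mat_A a) = transv n (block_vec 0 (1, 1)) (block_vec k (1, - 1)) a"
    and "E_block n k (mat_B a) = transv n (block_vec 0 (1, 1)) (block_vec k (1, 1)) (- a)"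
    and "E_block n k (mat_C a) = transv n (block_vec 0 (1, - 1)) (block_vec k (1, - 1)) a"
    and "E_block n k (mat_D a) = transv n (block_vec 0 (1, - 1)) (block_vec k (1, 1)) a"
  using E_block_eq_transv[OF assms, of a "(1, 1)" "(1, - 1)"]
    E_block_eq_transv[OF assms, of "- a" "(1, 1)" "(1, 1)"]
    E_block_eq_transv[OF assms, of a "(1, - 1)" "(1, - 1)"]
    E_block_eq_transv[OF assms, of a "(1, - 1)" "(1, 1)"]
  by (simp_all add: mat_A_def mat_B_def mat_C_def mat_D_def)

section \<open>Comparison with the group of all transvections\<close>

lemma generate_eq_transv_group:
  fixes S :: "'a::comm_ring_1 mat set"
  assumes two: "(2 :: 'a) dvd 1" and n: "n \<ge> 2" and unit: "(fst p * snd q - snd p * fst q) dvd 1"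
    and sub: "S \<subseteq> transv_set n"
    and gens: "\<And>k x y c. k \<in> {1..<n} \<Longrightarrow> x \<in> {p, q} \<Longrightarrow> y \<in> {p, q} \<Longrightarrow>
      transv n (block_vec 0 x) (block_vec k y) c \<in> S"
  shows "generate (Sp n) S = generate (Sp n) (transv_set n)"
proof -
  interpret group "Sp n :: 'a mat monoid" by (rule group_Sp)
  have sub': "S \<subseteq> carrier (Sp n)" using sub transv_set_subset_Sp[OF two] by blast
  have "transv_set n \<subseteq> generate (Sp n) S"
  proof (rule transv_set_subset[OF two _ unit n])
    show "A * B \<in> generate (Sp n) S" if "A \<in> generate (Sp n) S" "B \<in> generate (Sp n) S" for A B
      using generate.eng[OF that] by simp
  qed (use gens in \<open>auto intro: generate.incl\<close>)
  then have "generate (Sp n) (transv_set n) \<subseteq> generate (Sp n) S"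
    by (rule generate_subgroup_incl[OF _ generate_is_subgroup[OF sub']])
  with mono_generate[OF sub] show ?thesis by blast
qed

lemma H_subgroup_eq_transv_group:
  assumes two: "(2 :: 'a::comm_ring_1) dvd 1" and n: "n \<ge> 2"
  shows "H_subgroup n = generate (Sp n) (transv_set n :: 'a mat set)"
  unfolding H_subgroup_def
proof (rule generate_eq_transv_group[OF two n, of "(1, 1)" "(1, - 1)"])
  \<comment> \<open>The determinant is -2, a unit because 2 is invertible.\<close>
  show "(fst (1, 1) * snd (1, - 1) - snd (1, 1) * fst (1, - 1) :: 'a) dvd 1"
    using two by simp
next
  show "(\<Union>k\<in>{1..<n}. \<Union>a. {E_block n k (mat_A a), E_block n k (mat_B a),
      E_block n k (mat_C a), E_block n k (mat_D a)}) \<subseteq> (transv_set n :: 'a mat set)"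
  proof -
    have "transv n (block_vec 0 x) (block_vec k y) c \<in> transv_set n" if "k \<in> {1..<n}" for k x y and c :: 'a
      using that by (auto simp: transv_set_def sform_block_vec_block_vec intro!: exI[of _ "block_vec _ _"])
    then show ?thesis by (auto simp: E_block_mat_eq_transv)
  qed
next
  fix k x y and c :: 'a
  assume k: "k \<in> {1..<n}" and xy: "x \<in> {(1 :: 'a, 1 :: 'a), (1, - 1)}" "y \<in> {(1 :: 'a, 1 :: 'a), (1, - 1)}"
  from xy have "transv n (block_vec 0 x) (block_vec k y) c \<in> {E_block n k (mat_A c),
      E_block n k (mat_B (- c)), E_block n k (mat_C c), E_block n k (mat_D c)}"
    by (auto simp: E_block_mat_eq_transv[OF k])
  then show "transv n (block_vec 0 x) (block_vec k y) c \<in> (\<Union>k\<in>{1..<n}. \<Union>a. {E_block n k (mat_A a),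
      E_block n k (mat_B a), E_block n k (mat_C a), E_block n k (mat_D a)})"
    using k by blast
qed

lemma ESp_eq_transv_group:
  assumes two: "(2 :: 'a::comm_ring_1) dvd 1" and n: "n \<ge> 2"
  shows "ESp n = generate (Sp n) (transv_set n :: 'a mat set)"
  unfolding ESp_def
proof (rule generate_eq_transv_group[OF two n, of "(1, 0)" "(0, 1)"])
  obtain h :: 'a where h: "1 = 2 * h" using two by (auto elim: dvdE)
  \<comment> \<open>The elementary matrices were matched with transvections for entries of the form
    \<open>2 * x\<close>; halving reaches all entries.\<close>
  have half: "x = 2 * (h * x)" for x using h by (metis mult.assoc mult_1)
  have "E_elem n 0 1 x \<in> transv_set n" "E_elem n 1 0 x \<in> transv_set n" for x :: 'a
    by (subst half, unfold E_elem_0_1 E_elem_1_0 transv_set_def, use sform_self[OF two] in blast)+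
  moreover have "S_elem n i j x \<in> transv_set n" if "i < 2 * n" "i \<noteq> j" for i j and x :: 'a
  proof -
    have "sform n (\<lambda>k. if k = i then 1 else 0) (\<lambda>k. if k = swap_pair j then 1 else (0 :: 'a)) = 0"
      unfolding sform_def using that by (intro sum.neutral) auto
    then show ?thesis unfolding S_elem_eq_transv transv_set_def by blast
  qed
  ultimately show "{E_elem n 1 0 x | x. True} \<union> {E_elem n 0 1 x | x. True} \<union>
      {S_elem n i j x | i j x. i < 2 * n \<and> j < 2 * n \<and> i \<noteq> j \<and> j \<noteq> swap_pair i}
      \<subseteq> (transv_set n :: 'a mat set)"
    by blast
next
  fix k x y and c :: 'a
  assume k: "k \<in> {1..<n}" and xy: "x \<in> {(1 :: 'a, 0 :: 'a), (0, 1)}" "y \<in> {(1 :: 'a, 0 :: 'a), (0, 1)}"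
  have e: "block_vec m (1, 0) = (\<lambda>l. if l = 2 * m then 1 else (0 :: 'a))"
    "block_vec m (0, 1) = (\<lambda>l. if l = 2 * m + 1 then 1 else (0 :: 'a))" for m
    by (simp_all add: block_vec_def fun_eq_iff)
  obtain i where i: "i = 0 \<or> i = 1" "block_vec 0 x = (\<lambda>l. if l = i then 1 else 0)"
    using xy(1) e[of 0] by auto
  obtain j' where j': "j' = 2 * k \<or> j' = 2 * k + 1" "block_vec k y = (\<lambda>l. if l = j' then 1 else 0)"
    using xy(2) e[of k] by blast
  \<comment> \<open>The second vector attached to \<open>S_elem n i j\<close> is the unit vector at
    \<open>swap_pair j\<close>, so \<open>j\<close> must be the partner of
    \<open>j'\<close>.\<close>
  define j where "j = swap_pair j'"
  have j: "j = 2 * k \<or> j = 2 * k + 1" "j' = swap_pair j"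
    using j'(1) by (auto simp: j_def swap_pair_def)
  have "(- 1) ^ j * ((- 1) ^ j * c) = c"
    by (cases "even j") simp_all
  then have S: "transv n (block_vec 0 x) (block_vec k y) c = S_elem n i j (- ((- 1) ^ j * c))"
    by (simp add: S_elem_eq_transv i(2) j'(2) j(2))
  have "swap_pair i \<le> 1" using i(1) by (auto simp: swap_pair_def)
  then have "i < 2 * n \<and> j < 2 * n \<and> i \<noteq> j \<and> j \<noteq> swap_pair i"
    using k i(1) j(1) by fastforce
  then show "transv n (block_vec 0 x) (block_vec k y) c \<in> {E_elem n 1 0 x | x. True} \<union>
      {E_elem n 0 1 x | x. True} \<union>
      {S_elem n i j x | i j x. i < 2 * n \<and> j < 2 * n \<and> i \<noteq> j \<and> j \<noteq> swap_pair i}"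
    unfolding S by (intro UnI2 CollectI exI conjI refl; blast)
qed simp

theorem corollary4p7:
  fixes n :: nat
  assumes "(2 :: 'a::comm_ring_1) dvd 1" and "n \<ge> 2"
  shows "(H_subgroup n :: 'a mat set) = ESp n \<and> (H_subgroup n :: 'a mat set) \<lhd> Sp n"
  using H_subgroup_eq_transv_group[OF assms] ESp_eq_transv_group[OF assms]
    normal_generate_transv_set[OF assms(1)] by simp

end
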